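(* Let $\mathcal Z$ be a finite zero-set and let $a_0,b_0$ be positive integers with $\mathcal Z\subseteq R_{a_0,b_0}$. Then $$\gamma(\mathcal Z)=\min\{|A|: A\subseteq R_{a_0,b_0},\ A \text{ finite and spans}\}.$$ Equivalently: if $A\subseteq\mathbb Z_+^2$ is finite and spans, there is $B\subseteq R_{a_0,b_0}$ that spans with $|B|\le|A|$.
   Context: Let $\mathbb Z_+=\{0,1,2,\dots\}$ and, for positive integers $a,b$, let $R_{a,b}=([0,a-1]\times[0,b-1])\cap\mathbb Z_+^2$. A (discrete) zero-set is a set $\mathcal Z\subseteq\mathbb Z_+^2$ that is a union of rectangles $R_{a,b}$. For $A\subseteq\mathbb Z_+^2$ and $x\in\mathbb Z_+^2$ let $\mathrm{row}(x,A)$ (resp. $\mathrm{col}(x,A)$) be the number of points of $A$ on the horizontal (resp. vertical) line through $x$. The neighborhood growth transformation is $\mathcal T(A)=A\cup\{x\in\mathbb Z_+^2\setminus A:(\mathrm{row}(x,A),\mathrm{col}(x,A))\notin\mathcal Z\}$. A set $A$ spans if $\bigcup_{t\ge0}\mathcal T^t(A)=\mathbb Z_+^2$. $\gamma(\mathcal Z)$ is the minimum cardinality of a finite spanning set. *)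

theory Defs
  imports Main "HOL-Library.Extended_Nat"
begin

type_synonym pt = "nat \<times> nat"

definition Rect :: "nat \<Rightarrow> nat \<Rightarrow> pt set" where
  "Rect a b = {(i, j). i < a \<and> j < b}"

definition zero_set :: "pt set \<Rightarrow> bool" where
  "zero_set Z \<longleftrightarrow> (\<exists>S. (\<forall>(a, b) \<in> S. a > 0 \<and> b > 0) \<and> Z = (\<Union>(a, b) \<in> S. Rect a b))"

definition ecount :: "pt set \<Rightarrow> enat" where
  "ecount S = (if finite S then enat (card S) else \<infinity>)"

definition row :: "pt \<Rightarrow> pt set \<Rightarrow> enat" where
  "row x A = ecount {y \<in> A. snd y = snd x}"

definition col :: "pt \<Rightarrow> pt set \<Rightarrow> enat" where
  "col x A = ecount {y \<in> A. fst y = fst x}"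

definition in_Z :: "pt set \<Rightarrow> enat \<Rightarrow> enat \<Rightarrow> bool" where
  "in_Z Z r c \<longleftrightarrow> (\<exists>m n. r = enat m \<and> c = enat n \<and> (m, n) \<in> Z)"

definition NG :: "pt set \<Rightarrow> pt set \<Rightarrow> pt set" where
  "NG Z A = A \<union> {x. x \<notin> A \<and> \<not> in_Z Z (row x A) (col x A)}"

definition spans :: "pt set \<Rightarrow> pt set \<Rightarrow> bool" where
  "spans Z A \<longleftrightarrow> (\<Union>t. (NG Z ^^ t) A) = UNIV"

definition gamma :: "pt set \<Rightarrow> nat" where
  "gamma Z = (LEAST n. \<exists>A. finite A \<and> spans Z A \<and> card A = n)"

end

theory Submission
  imports Defs
begin

text \<open>
  Enclose the finite spanning set in a large box, where spanning may be tested inside the box, and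
  remove lines one at a time while the box has more than \<open>b0\<close> rows (or, after transposition, more
  than \<open>a0\<close> columns). To empty the last row, repeatedly decrease its initial number of points.
  If the last row is at all times a least occupied one, everything it acquires lies in a column that
  is filled anyway, so its role is only to contribute its initial points to column counts; such a
  point can be moved within its column to the row that becomes occupied there last. Otherwise let
  \<open>t\<close> be the first time at which some row \<open>j\<close>, taken least occupied, has fewer points than the last
  row, and exchange the initial points of these two rows in all columns not acquired by row \<open>j\<close>
  before \<open>t\<close>. The new row \<open>j\<close> keeps up with the old one until \<open>t\<close> and then covers the old last row,
  while all columns acquired by row \<open>j\<close> become filled because row \<open>j\<close> was least occupied. Hence the
  new set still spans, and its last row has fewer points.
\<close>

section \<open>Counting, closure and spanning inside a finite box\<close>

text \<open>Natural-number counts make the arguments inside a box elementary. Since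
  \<open>card\<close> is 0 on infinite sets, the link with \<open>row\<close> and \<open>col\<close>
  later carries finiteness conditions.\<close>

definition row_card :: "pt set \<Rightarrow> nat \<Rightarrow> nat" where
  "row_card A j = card {i. (i, j) \<in> A}"

definition col_card :: "pt set \<Rightarrow> nat \<Rightarrow> nat" where
  "col_card A i = card {j. (i, j) \<in> A}"

definition box_closed :: "pt set \<Rightarrow> nat \<Rightarrow> nat \<Rightarrow> pt set \<Rightarrow> bool" where
  "box_closed Z M N C \<longleftrightarrow> C \<subseteq> Rect M N \<and>
     (\<forall>i<M. \<forall>j<N. (row_card C j, col_card C i) \<notin> Z \<longrightarrow> (i, j) \<in> C)"

text \<open>Phrased by closed supersets instead of iteration: to see that a modified set spans, it
  suffices to trace the old growth inside an arbitrary closed superset \<open>C\<close>. Where times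
  matter, \<open>box_step\<close> supplies them.\<close>

definition box_spans :: "pt set \<Rightarrow> nat \<Rightarrow> nat \<Rightarrow> pt set \<Rightarrow> bool" where
  "box_spans Z M N A \<longleftrightarrow> A \<subseteq> Rect M N \<and>
     (\<forall>C. box_closed Z M N C \<longrightarrow> A \<subseteq> C \<longrightarrow> C = Rect M N)"

definition box_step :: "pt set \<Rightarrow> nat \<Rightarrow> nat \<Rightarrow> pt set \<Rightarrow> pt set" where
  "box_step Z M N X =
     X \<union> {(i, j). i < M \<and> j < N \<and> (row_card X j, col_card X i) \<notin> Z}"

definition down_closed :: "pt set \<Rightarrow> bool" where
  "down_closed Z \<longleftrightarrow> (\<forall>r c r' c'. (r, c) \<in> Z \<longrightarrow> r' \<le> r \<longrightarrow> c' \<le> c \<longrightarrow> (r', c') \<in> Z)"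

lemma down_closedD: "down_closed Z \<Longrightarrow> (r, c) \<in> Z \<Longrightarrow> r' \<le> r \<Longrightarrow> c' \<le> c \<Longrightarrow> (r', c') \<in> Z"
  unfolding down_closed_def by blast

lemma zero_set_down_closed: "zero_set Z \<Longrightarrow> down_closed Z"
  unfolding zero_set_def down_closed_def Rect_def by fastforce

lemma finite_Rect [simp]: "finite (Rect M N)"
proof -
  have "Rect M N = {..<M} \<times> {..<N}" by (auto simp: Rect_def)
  then show ?thesis by simp
qed

lemma mem_Rect [simp]: "(i, j) \<in> Rect M N \<longleftrightarrow> i < M \<and> j < N"
  by (simp add: Rect_def)

lemma finite_row: "finite A \<Longrightarrow> finite {i. (i, j) \<in> A}"
  by (rule finite_subset[of _ "fst ` A"]) force+

lemma finite_col: "finite A \<Longrightarrow> finite {j. (i, j) \<in> A}"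
  by (rule finite_subset[of _ "snd ` A"]) force+

lemma row_card_mono: "finite B \<Longrightarrow> A \<subseteq> B \<Longrightarrow> row_card A j \<le> row_card B j"
  unfolding row_card_def by (rule card_mono) (auto simp: finite_row)

lemma col_card_mono: "finite B \<Longrightarrow> A \<subseteq> B \<Longrightarrow> col_card A i \<le> col_card B i"
  unfolding col_card_def by (rule card_mono) (auto simp: finite_col)

text \<open>Allows comparing a column of the old growth with a column of \<open>C\<close> after its
  rows have been permuted.\<close>

lemma col_card_inj_le:
  assumes "finite B" "inj f" "\<And>j. (i, j) \<in> A \<Longrightarrow> (i, f j) \<in> B"
  shows "col_card A i \<le> col_card B i"
  unfolding col_card_def
  by (rule card_inj_on_le[of f]) (use assms in \<open>auto simp: finite_col inj_on_def\<close>)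

lemma box_closed_subset: "box_closed Z M N C \<Longrightarrow> C \<subseteq> Rect M N"
  by (simp add: box_closed_def)

lemma box_closed_finite: "box_closed Z M N C \<Longrightarrow> finite C"
  by (meson box_closed_subset finite_Rect finite_subset)

lemma box_closedD:
  "box_closed Z M N C \<Longrightarrow> i < M \<Longrightarrow> j < N \<Longrightarrow> (row_card C j, col_card C i) \<notin> Z \<Longrightarrow> (i, j) \<in> C"
  by (simp add: box_closed_def)

lemma col_card_ge:
  assumes "finite C" "\<And>k. k < n \<Longrightarrow> (i, k) \<in> C"
  shows "n \<le> col_card C i"
proof -
  have "card {..<n} \<le> card {j. (i, j) \<in> C}"
    by (rule card_mono) (use assms in \<open>auto simp: finite_col\<close>)
  then show ?thesis by (simp add: col_card_def)
qed

lemma funpow_increasing: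
  fixes f :: "'a set \<Rightarrow> 'a set"
  assumes "\<And>X. X \<subseteq> f X" "s \<le> t"
  shows "(f ^^ s) A \<subseteq> (f ^^ t) A"
  using \<open>s \<le> t\<close> by (induction t rule: dec_induct) (use assms(1) in auto)

lemma finite_subset_increasing:
  fixes X :: "nat \<Rightarrow> 'a set"
  assumes "finite F" "F \<subseteq> (\<Union>t. X t)" "\<And>s t. s \<le> t \<Longrightarrow> X s \<subseteq> X t"
  shows "\<exists>T. F \<subseteq> X T"
  using assms(1,2)
proof (induction F rule: finite_induct)
  case (insert p F)
  then obtain T s where "F \<subseteq> X T" "p \<in> X s" by auto
  then have "insert p F \<subseteq> X (max s T)"
    using assms(3)[of s "max s T"] assms(3)[of T "max s T"] by auto
  then show ?case by blast
qed simp

text \<open>The iterates increase inside a finite box, so they stabilise; a stable iterate is closed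
  and contains \<open>A\<close>.\<close>

lemma box_spans_reaches:
  assumes "box_spans Z M N A"
  shows "\<exists>T. (box_step Z M N ^^ T) A = Rect M N"
proof -
  let ?X = "\<lambda>t. (box_step Z M N ^^ t) A"
  have mono: "?X s \<subseteq> ?X t" if "s \<le> t" for s t
    by (rule funpow_increasing[OF _ that]) (simp add: box_step_def)
  have sub: "?X t \<subseteq> Rect M N" for t
  proof (induction t)
    case 0 then show ?case using assms by (simp add: box_spans_def)
  next
    case (Suc t) then show ?case by (auto simp: box_step_def)
  qed
  then have "(\<Union>t. ?X t) \<subseteq> Rect M N" by blast
  then obtain T where T: "(\<Union>t. ?X t) \<subseteq> ?X T"
    using finite_subset_increasing[of "\<Union>t. ?X t" ?X] mono finite_subset[OF _ finite_Rect]
    by blast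
  have "box_step Z M N (?X T) \<subseteq> ?X T"
    using T by (metis UN_subset_iff UNIV_I funpow.simps(2) o_apply)
  then have "box_closed Z M N (?X T)"
    using sub by (auto simp: box_closed_def box_step_def)
  moreover have "A \<subseteq> ?X T" using mono[of 0 T] by simp
  ultimately show ?thesis using assms by (auto simp: box_spans_def)
qed

section \<open>Reducing the number of initial points in the last row\<close>

lemma last_row_shrink:
  assumes down: "down_closed Z" and bnd: "\<And>r c. (r, c) \<in> Z \<Longrightarrow> c < n" and n: "0 < n"
    and sp: "box_spans Z M (Suc n) A" and i0: "(i0, n) \<in> A"
  shows "\<exists>A'. box_spans Z M (Suc n) A' \<and> card A' \<le> card A \<and> row_card A' n < row_card A n"
proof -
  define X where "X t = (box_step Z M (Suc n) ^^ t) A" for t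
  \<comment> \<open>\<open>H s k i\<close> says that the growth rule fires at \<open>(i, k)\<close>
    at time \<open>s\<close>, whether or not the point is already occupied.\<close>
  define H where "H s k i \<longleftrightarrow> (row_card (X s) k, col_card (X s) i) \<notin> Z" for s k i
  have A: "A \<subseteq> Rect M (Suc n)" and finA: "finite A"
    using sp by (auto simp: box_spans_def intro: finite_subset[OF _ finite_Rect])
  have i0M: "i0 < M" using i0 A by auto
  have X0: "X 0 = A" by (simp add: X_def)
  have XS: "(i, k) \<in> X (Suc t) \<longleftrightarrow> (i, k) \<in> X t \<or> i < M \<and> k \<le> n \<and> H t k i" for i k t
    by (auto simp: X_def H_def box_step_def)
  have Xmono: "X s \<subseteq> X t" if "s \<le> t" for s t
    unfolding X_def by (rule funpow_increasing[OF _ that]) (simp add: box_step_def)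
  have Xsub: "X t \<subseteq> Rect M (Suc n)" for t
  proof (induction t)
    case 0 then show ?case using A by (simp add: X0)
  next
    case (Suc t) then show ?case by (auto simp: subset_iff XS)
  qed
  have Xfin: "finite (X t)" for t by (rule finite_subset[OF Xsub]) simp
  obtain T where T: "X T = Rect M (Suc n)"
    using box_spans_reaches[OF sp] unfolding X_def by blast
  \<comment> \<open>A column occupied in the first \<open>n\<close> rows has count at least
    \<open>n\<close>, which exceeds every height in \<open>Z\<close>, so its point in row
    \<open>n\<close> follows.\<close>
  have full: "(i, j) \<in> C" if "box_closed Z M (Suc n) C" "i < M" "j \<le> n" "\<And>k. k < n \<Longrightarrow> (i, k) \<in> C" for C i j
    using box_closedD[OF that(1,2), of j] bnd col_card_ge[OF box_closed_finite[OF that(1)] that(4)] that(3)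
    by force
  have Xiff: "(i, k) \<in> X t \<longleftrightarrow> (i, k) \<in> A \<or> i < M \<and> k \<le> n \<and> (\<exists>s<t. H s k i)" for i k t
  proof (induction t)
    case 0 then show ?case by (simp add: X0)
  next
    case (Suc t) then show ?case unfolding XS by (auto simp: less_Suc_eq)
  qed
  \<comment> \<open>Column counts only grow, so firing passes to any later time and any row that is
    then at least as occupied.\<close>
  have Hmono: "H t l i" if "H s k i" "row_card (X s) k \<le> row_card (X t) l" "s \<le> t" for s t k l i
    using that down_closedD[OF down] col_card_mono[OF Xfin Xmono[OF that(3)]] unfolding H_def by blast
  show ?thesis
  proof (cases "\<forall>t. \<forall>k<n. row_card (X t) n \<le> row_card (X t) k")
    case True
    \<comment> \<open>\<open>f k\<close> is the time at which \<open>(i0, k)\<close> becomes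
      occupied. The row \<open>k\<close> chosen below maximises it, so once \<open>(i0, k)\<close>
      is occupied, column \<open>i0\<close> is occupied in all first \<open>n\<close> rows.\<close>
    define f where "f k = (LEAST t. (i0, k) \<in> X t)" for k
    have f: "(i0, k) \<in> X (f k)" if "k < n" for k
      unfolding f_def by (rule LeastI[of _ T]) (use that i0M T in auto)
    have "Max (f ` {..<n}) \<in> f ` {..<n}" by (rule Max_in) (use n in auto)
    then obtain k where k: "k < n" "f k = Max (f ` {..<n})" by auto
    have last: "(i0, k') \<in> X t" if "(i0, k) \<in> X t" "k' < n" for k' t
    proof -
      have "f k' \<le> f k" unfolding k(2) by (rule Max_ge) (use that in auto)
      also have "f k \<le> t" unfolding f_def by (rule Least_le) (rule that)
      finally show ?thesis using f[OF that(2)] Xmono by blast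
    qed
    define A' where "A' = insert (i0, k) (A - {(i0, n)})"
    have "row_card A' n < row_card A n" unfolding row_card_def
      by (rule psubset_card_mono[OF finite_row[OF finA]]) (use i0 k in \<open>auto simp: A'_def\<close>)
    moreover have "card A' \<le> card A"
    proof -
      have "card A' \<le> Suc (card (A - {(i0, n)}))" unfolding A'_def by (rule card_insert_le_m1) (use finA in auto)
      also have "\<dots> = card A" by (rule card_Suc_Diff1[OF finA i0])
      finally show ?thesis .
    qed
    moreover have "box_spans Z M (Suc n) A'"
      unfolding box_spans_def
    proof (intro conjI allI impI)
      show "A' \<subseteq> Rect M (Suc n)" using A i0M k by (auto simp: A'_def)
    next
      fix C assume C: "box_closed Z M (Suc n) C" "A' \<subseteq> C"
      note finC = box_closed_finite[OF C(1)]
      \<comment> \<open>Only the removed point is exempt from the comparison; it is recovered at the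
        end, when column \<open>i0\<close> is full below it.\<close>
      have XC: "X t - {(i0, n)} \<subseteq> C" for t
      proof (induction t)
        case 0 then show ?case using C(2) by (auto simp: X0 A'_def)
      next
        case (Suc t)
        have up: "(i, l) \<in> C" if "(i, l) \<in> X (Suc t)" "l < n" for i l
        proof (cases "(i, l) \<in> X t")
          case True then show ?thesis using Suc that(2) by blast
        next
          case False
          then have H: "H t l i" and iM: "i < M" using that XS by auto
          have row: "row_card (X t) l \<le> row_card C l" unfolding row_card_def
            by (rule card_mono[OF finite_row[OF finC]]) (use Suc that(2) in auto)
          show ?thesis
          \<comment> \<open>Once \<open>(i0, k)\<close> is occupied, the whole column lies in
            \<open>C\<close>. Until then position \<open>k\<close> is free, so sending
            \<open>n\<close> to \<open>k\<close> injects the old column into that of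
            \<open>C\<close>.\<close>
          proof (cases "i = i0 \<and> (i0, k) \<in> X t")
            case True
            then have "(i, k') \<in> C" if "k' < n" for k' using last[of t k'] Suc that by auto
            then show ?thesis using full[OF C(1) iM, of l] that by auto
          next
            case False
            have "col_card (X t) i \<le> col_card C i"
            proof (cases "i = i0")
              case i: True
              show ?thesis unfolding col_card_def
                by (rule card_inj_on_le[of "\<lambda>l. if l = n then k else l"])
                  (use Suc False i C(2) in \<open>auto simp: inj_on_def A'_def finite_col[OF finC]\<close>)
            next
              case False
              then show ?thesis unfolding col_card_def
                by (intro card_mono[OF finite_col[OF finC]]) (use Suc in auto)
            qed
            then have "(row_card C l, col_card C i) \<notin> Z"
              using H row down_closedD[OF down] unfolding H_def by blast
            then show ?thesis using box_closedD[OF C(1) iM] that by auto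
          qed
        qed
        show ?case
        proof
          fix p assume p: "p \<in> X (Suc t) - {(i0, n)}"
          obtain i l where pil: "p = (i, l)" by fastforce
          show "p \<in> C"
          proof (cases "l < n \<or> p \<in> X t")
            case True then show ?thesis using up p pil Suc by blast
          next
            case False
            then have H: "H t l i" and iM: "i < M" and l: "l = n" using p pil XS by auto
            \<comment> \<open>Row \<open>n\<close> is least occupied, so firing there means firing
              in every row \<open>k'\<close> at the same time; \<open>up\<close> already covers
              those points.\<close>
            have "(i, k') \<in> C" if "k' < n" for k'
              using up[of i k'] XS Hmono[OF H, of t k'] \<open>\<forall>t. \<forall>k<n. _ t k\<close> that iM l by auto
            then show ?thesis using full[OF C(1) iM, of l] l pil by auto
          qed
        qed
      qed
      have "(i0, k') \<in> C" if "k' < n" for k' using XC[of T] T that i0M by auto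
      then have "(i0, n) \<in> C" using full[OF C(1) i0M] by auto
      then have "Rect M (Suc n) \<subseteq> C" using XC[of T] T by auto
      then show "C = Rect M (Suc n)" using box_closed_subset[OF C(1)] by auto
    qed
    ultimately show ?thesis by blast
  next
    case False
    define t where "t = (LEAST t. \<exists>k<n. row_card (X t) k < row_card (X t) n)"
    have ex: "\<exists>k<n. row_card (X t) k < row_card (X t) n"
      unfolding t_def by (rule LeastI_ex) (use False in \<open>auto simp: not_le\<close>)
    have before: "row_card (X s) n \<le> row_card (X s) k" if s: "s < t" and k: "k \<le> n" for s k
    proof (rule ccontr)
      assume less: "\<not> ?thesis"
      then have "k < n" using k by (cases "k = n") auto
      then have "t \<le> s" unfolding t_def using less by (intro Least_le) auto
      then show False using s by simp
    qed
    obtain j where j: "j < n" "\<And>k. k < n \<Longrightarrow> row_card (X t) j \<le> row_card (X t) k"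
      using ex_min_if_finite[of "row_card (X t) ` {..<n}"] n by (auto simp: not_less)
    have jn: "row_card (X t) j < row_card (X t) n" using ex j(2) by fastforce
    \<comment> \<open>The columns acquired by row \<open>j\<close> before \<open>t\<close>. They may
      also hold initial points of row \<open>j\<close>, so only \<open>aj - G\<close> counts as the
      remainder of that row.\<close>
    define G where "G = {i. i < M \<and> (\<exists>s<t. H s j i)}"
    define aj where "aj = {i. (i, j) \<in> A}"
    define an where "an = {i. (i, n) \<in> A}"
    have fin: "finite aj" "finite an" "finite G"
      using finite_row[OF finA] by (auto simp: aj_def an_def G_def)
    define f where "f k = (if k = j then n else if k = n then j else k)" for k
    have f_inv: "f (f k) = k" and f_le: "k \<le> n \<Longrightarrow> f k \<le> n" for k using j(1) by (auto simp: f_def)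
    have f_inj: "inj f" by (metis f_inv injI)
    \<comment> \<open>In each column this is an involution of the rows: the exchange of
      \<open>j\<close> and \<open>n\<close> off \<open>G\<close>, the identity on \<open>G\<close>.
      Hence \<open>A'\<close> is no larger than \<open>A\<close>.\<close>
    define h where "h i k = (if i \<in> G then k else f k)" for i k
    have h_inv: "h i (h i k) = k" and h_le: "k \<le> n \<Longrightarrow> h i k \<le> n" for i k
      by (simp_all add: h_def f_inv f_le)
    define A' where "A' = {(i, k). (i, h i k) \<in> A}"
    \<comment> \<open>Before \<open>t\<close> the last row is least occupied, so whatever it
      acquires lies in \<open>G\<close>. At time \<open>t\<close> both rows are thus compared modulo
      \<open>G\<close>, and row \<open>j\<close> contains all of \<open>G\<close>.\<close>
    have tail: "card (aj - G) < card (an - G)"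
    proof -
      have Xj: "{i. (i, j) \<in> X t} = (aj - G) \<union> G"
        using j(1) by (auto simp: Xiff aj_def G_def)
      have "{i. (i, n) \<in> X t} \<subseteq> (an - G) \<union> G"
        using Hmono before j(1) by (force simp: Xiff an_def G_def)
      then have "row_card (X t) n \<le> card ((an - G) \<union> G)"
        unfolding row_card_def by (rule card_mono[rotated]) (use fin in auto)
      also have "\<dots> = card (an - G) + card G" by (rule card_Un_disjoint) (use fin in auto)
      finally have "row_card (X t) n \<le> card (an - G) + card G" .
      moreover have "row_card (X t) j = card (aj - G) + card G"
        unfolding row_card_def Xj by (rule card_Un_disjoint) (use fin in auto)
      ultimately show ?thesis using jn by simp
    qed
    have "row_card A' n < row_card A n"
    proof -
      have "{i. (i, n) \<in> A'} = (an \<inter> G) \<union> (aj - G)"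
        by (auto simp: A'_def h_def f_def an_def aj_def)
      then have "row_card A' n = card (an \<inter> G) + card (aj - G)"
        unfolding row_card_def using fin by (simp add: card_Un_disjoint Int_Diff disjoint_iff)
      moreover have "row_card A n = card (an \<inter> G) + card (an - G)"
        using card_Int_Diff[OF fin(2), of G] by (simp add: row_card_def an_def)
      ultimately show ?thesis using tail by simp
    qed
    moreover have "card A' \<le> card A"
    proof (rule card_inj_on_le)
      show "inj_on (\<lambda>(i, k). (i, h i k)) A'"
        by (rule inj_on_inverseI[of _ "\<lambda>(i, k). (i, h i k)"]) (auto simp: h_inv)
      show "(\<lambda>(i, k). (i, h i k)) ` A' \<subseteq> A" by (auto simp: A'_def)
    qed (rule finA)
    moreover have "box_spans Z M (Suc n) A'"
      unfolding box_spans_def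
    proof (intro conjI allI impI)
      show "A' \<subseteq> Rect M (Suc n)"
      proof
        fix p assume "p \<in> A'"
        then obtain i k where p: "p = (i, k)" "(i, h i k) \<in> A" by (auto simp: A'_def)
        then have "i < M" "h i k \<le> n" using A by auto
        moreover have "k \<le> n" using h_le[OF \<open>h i k \<le> n\<close>, of i] by (simp add: h_inv)
        ultimately show "p \<in> Rect M (Suc n)" using p by auto
      qed
    next
      fix C assume C: "box_closed Z M (Suc n) C" "A' \<subseteq> C"
      note finC = box_closed_finite[OF C(1)]
      have AC: "(i, h i k) \<in> C" if "(i, k) \<in> A" for i k
        using that C(2) by (auto simp: A'_def h_inv)
      \<comment> \<open>In row \<open>j\<close> only points acquired by growth are claimed, because
        its initial points off \<open>G\<close> have moved to row \<open>n\<close>. The last row is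
        not tracked.\<close>
      define P where "P s \<longleftrightarrow> (\<forall>i k. k < n \<longrightarrow> k \<noteq> j \<longrightarrow> (i, k) \<in> X s \<longrightarrow> (i, k) \<in> C) \<and>
          (\<forall>i<M. \<forall>s'<s. H s' j i \<longrightarrow> (i, j) \<in> C)" for s
      \<comment> \<open>Row \<open>k\<close> of \<open>C\<close> may stand in for row
        \<open>l\<close> of the old growth. The column counts are compared through
        \<open>h i\<close>, assuming column \<open>i\<close> is not already full in
        \<open>C\<close>.\<close>
      have grow: "(i, k) \<in> C"
        if P: "P s" and s: "s \<le> t" and i: "i < M" and k: "k \<le> n"
          and H: "H s l i" and le: "row_card (X s) l \<le> row_card C k" for s l i k
      proof (cases "\<forall>k<n. (i, k) \<in> C")
        case True then show ?thesis using full[OF C(1) i k] by blast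
      next
        case False
        have "col_card (X s) i \<le> col_card C i"
        proof (rule col_card_inj_le[OF finC, of "h i"])
          show "inj (h i)" by (metis h_inv injI)
          fix l assume l: "(i, l) \<in> X s"
          show "(i, h i l) \<in> C"
          proof (cases "(i, l) \<in> A")
            case True then show ?thesis by (rule AC)
          next
            case notA: False
            then obtain s' where s': "s' < s" "H s' l i" and ln: "l \<le> n" using l Xiff by auto
            show ?thesis
            proof (cases "l = n")
              case True
              \<comment> \<open>A point acquired by the last row before \<open>t\<close> fires in
                all rows, so column \<open>i\<close> would be full in \<open>C\<close>, against the
                case assumption.\<close>
              have all: "H s' k' i" if "k' < n" for k'
                using Hmono[OF s'(2)] before[of s' k'] True s' s that by auto
              have "(i, k') \<in> C" if "k' < n" for k'
              proof (cases "k' = j")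
                case True then show ?thesis using P all[OF that] s'(1) i unfolding P_def by blast
              next
                case False
                have "(i, k') \<in> X s" using Xiff all[OF that] s'(1) i that by auto
                then show ?thesis using P that False unfolding P_def by blast
              qed
              then show ?thesis using False by blast
            next
              case lnn: False
              show ?thesis
              proof (cases "l = j")
                case True
                then have "i \<in> G" unfolding G_def using i s'(2) less_le_trans[OF s'(1) s] by blast
                then show ?thesis using P True s' i unfolding P_def by (auto simp: h_def)
              next
                case False
                then have "h i l = l" using lnn by (simp add: h_def f_def)
                then show ?thesis using P False lnn ln l unfolding P_def by auto
              qed
            qed
          qed
        qed
        then have "(row_card C k, col_card C i) \<notin> Z"
          using H le down_closedD[OF down] unfolding H_def by blast
        then show ?thesis using box_closedD[OF C(1) i] k by auto
      qed
      have rows: "row_card (X s) k \<le> row_card C k" if "P s" "k < n" "k \<noteq> j" for s k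
        unfolding row_card_def by (rule card_mono[OF finite_row[OF finC]]) (use that in \<open>auto simp: P_def\<close>)
      have rowj: "row_card (X s) j \<le> row_card C j" if P: "P s" and s: "s \<le> t" for s
      proof -
        \<comment> \<open>\<open>B\<close> is the part of row \<open>j\<close> lying in
          \<open>G\<close> at time \<open>s\<close>; it survives in \<open>C\<close>. The remainder
          \<open>aj - G\<close> is replaced by the larger set \<open>an - G\<close>.\<close>
        define B where "B = (aj \<inter> G) \<union> {i. i < M \<and> (\<exists>s'<s. H s' j i)}"
        have BG: "B \<subseteq> G" unfolding B_def G_def using less_le_trans[OF _ s] by blast
        then have finB: "finite B" using fin finite_subset by blast
        have "{i. (i, j) \<in> X s} \<subseteq> (aj - G) \<union> B"
          using j(1) by (auto simp: Xiff aj_def B_def)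
        then have "row_card (X s) j \<le> card ((aj - G) \<union> B)"
          unfolding row_card_def by (rule card_mono[rotated]) (use fin finB in auto)
        also have "\<dots> \<le> card (aj - G) + card B" by (rule card_Un_le)
        also have "\<dots> \<le> card (an - G) + card B" using tail by simp
        also have "\<dots> = card ((an - G) \<union> B)"
          by (rule card_Un_disjoint[symmetric]) (use fin finB BG in auto)
        also have "\<dots> \<le> row_card C j"
          unfolding row_card_def
        proof (rule card_mono[OF finite_row[OF finC]], rule subsetI)
          fix i assume i: "i \<in> (an - G) \<union> B"
          show "i \<in> {i. (i, j) \<in> C}"
            using i AC[of i n] AC[of i j] P
            by (auto simp: an_def aj_def B_def h_def f_def P_def split: if_splits)
        qed
        finally show ?thesis .
      qed
      have Pt: "P s" if "s \<le> t" for s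
        using that
      proof (induction s)
        case 0
        have "(i, k) \<in> C" if "k < n" "k \<noteq> j" "(i, k) \<in> A" for i k
          using AC[OF that(3)] that by (simp add: h_def f_def split: if_splits)
        then show ?case by (simp add: P_def X0)
      next
        case (Suc s)
        then have P: "P s" and s: "s \<le> t" by auto
        show ?case unfolding P_def
        proof (intro conjI allI impI)
          fix i k assume a: "k < n" "k \<noteq> j" "(i, k) \<in> X (Suc s)"
          show "(i, k) \<in> C"
          proof (cases "(i, k) \<in> X s")
            case True then show ?thesis using P a unfolding P_def by blast
          next
            case False
            then show ?thesis using grow[OF P s _ _ _ rows[OF P a(1,2)]] a XS by auto
          qed
        next
          fix i s' assume a: "i < M" "s' < Suc s" "H s' j i"
          show "(i, j) \<in> C"
          proof (cases "s' = s")
            case True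
            then show ?thesis using grow[OF P s a(1) _ _ rowj[OF P s]] a j(1) by auto
          next
            case False
            then have "s' < s" using a(2) by simp
            then show ?thesis using P a unfolding P_def by blast
          qed
        qed
      qed
      note P = Pt[OF order_refl]
      \<comment> \<open>At time \<open>t\<close> row \<open>j\<close> is least occupied among the
        first \<open>n\<close> rows, so its firing carries over to each of those rows of
        \<open>C\<close>.\<close>
      have GC: "(i, k) \<in> C" if i: "i \<in> G" and k: "k \<le> n" for i k
      proof (rule full[OF C(1) _ k])
        show "i < M" using i by (simp add: G_def)
        fix l assume l: "l < n"
        obtain s where s: "s < t" "H s j i" using i by (auto simp: G_def)
        have "row_card (X s) j \<le> row_card (X t) j"
          by (rule row_card_mono[OF Xfin Xmono]) (use s in simp)
        then have "H t j i" using Hmono[OF s(2)] s by auto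
        moreover have "row_card (X t) j \<le> row_card C l"
          using rowj[OF P] rows[OF P l] j(2)[OF l] by (cases "l = j") auto
        ultimately show "(i, l) \<in> C" using grow[OF P order_refl \<open>i < M\<close>] l by auto
      qed
      \<comment> \<open>\<open>D\<close> is \<open>C\<close> with rows \<open>j\<close> and
        \<open>n\<close> exchanged in every column, which preserves closedness. It contains
        \<open>A\<close>: off \<open>G\<close> this undoes \<open>h\<close>, and the columns in
        \<open>G\<close> are full in \<open>C\<close>.\<close>
      define D where "D = {(i, k). (i, f k) \<in> C}"
      have D_row: "row_card D k = row_card C (f k)" for k by (simp add: row_card_def D_def)
      have D_col: "col_card D i = col_card C i" for i
        unfolding col_card_def
        by (rule bij_betw_same_card[of f], rule bij_betw_byWitness[of _ f]) (auto simp: D_def f_inv)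
      have "box_closed Z M (Suc n) D"
        unfolding box_closed_def D_row D_col
      proof (intro conjI allI impI)
        show "D \<subseteq> Rect M (Suc n)"
        proof
          fix p assume "p \<in> D"
          then obtain i k where p: "p = (i, k)" "(i, f k) \<in> C" by (auto simp: D_def)
          then have "i < M" "f k \<le> n" using box_closed_subset[OF C(1)] by auto
          then show "p \<in> Rect M (Suc n)" using p f_le[of "f k"] f_inv[of k] by auto
        qed
        fix i k assume "i < M" "k < Suc n" "(row_card C (f k), col_card C i) \<notin> Z"
        then show "(i, k) \<in> D" using box_closedD[OF C(1), of i "f k"] f_le[of k] by (auto simp: D_def)
      qed
      moreover have "A \<subseteq> D"
      proof
        fix p assume "p \<in> A"
        then obtain i k where p: "p = (i, k)" "(i, k) \<in> A" by (cases p) auto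
        then have "k \<le> n" using A by auto
        then have "(i, f k) \<in> C"
          using AC[OF p(2)] GC[of i "f k"] f_le[of k] by (auto simp: h_def split: if_splits)
        then show "p \<in> D" using p by (simp add: D_def)
      qed
      ultimately have D: "D = Rect M (Suc n)" using sp by (auto simp: box_spans_def)
      have "(i, k) \<in> C" if "i < M" "k \<le> n" for i k
      proof -
        have "(i, f k) \<in> D" using D that f_le by (simp add: less_Suc_eq_le)
        then show ?thesis by (simp add: D_def f_inv)
      qed
      then show "C = Rect M (Suc n)" using box_closed_subset[OF C(1)] by (auto simp: Rect_def less_Suc_eq_le)
    qed
    ultimately show ?thesis by blast
  qed
qed

section \<open>Deleting surplus rows and columns\<close>

text \<open>A closed set of the smaller box extends to the larger one by occupying row
  \<open>n\<close> exactly over its full columns.\<close>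

lemma box_spans_drop_empty_row:
  assumes down: "down_closed Z" and sp: "box_spans Z M (Suc n) A" and A: "A \<subseteq> Rect M n"
  shows "box_spans Z M n A"
  unfolding box_spans_def
proof (intro conjI allI impI)
  fix C assume C: "box_closed Z M n C" "A \<subseteq> C"
  note finC = box_closed_finite[OF C(1)] and subC = box_closed_subset[OF C(1)]
  define D where "D = C \<union> {(i, l). l = n \<and> i < M \<and> (\<forall>k<n. (i, k) \<in> C)}"
  have row: "row_card D k = row_card C k" if "k < n" for k
    using that by (simp add: row_card_def D_def)
  have col: "col_card D i = col_card C i" if "\<not> (\<forall>k<n. (i, k) \<in> C)" for i
    unfolding col_card_def using that by (intro arg_cong[of _ _ card]) (auto simp: D_def)
  have "box_closed Z M (Suc n) D"
    unfolding box_closed_def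
  proof (intro conjI allI impI)
    show "D \<subseteq> Rect M (Suc n)" using subC by (force simp: D_def Rect_def)
    fix i k assume a: "i < M" "k < Suc n" "(row_card D k, col_card D i) \<notin> Z"
    show "(i, k) \<in> D"
    proof (cases "\<forall>k<n. (i, k) \<in> C")
      case True then show ?thesis using a by (auto simp: D_def less_Suc_eq)
    next
      case False
      note ci = col[OF False]
      show ?thesis
      proof (cases "k < n")
        case True then show ?thesis using a box_closedD[OF C(1)] row ci by (auto simp: D_def)
      next
        case kn: False
        \<comment> \<open>Row \<open>n\<close> of \<open>D\<close> lies over full columns only, so
          every row \<open>l\<close> of \<open>C\<close> has at least as many points and is forced
          at \<open>i\<close> too.\<close>
        have "(i, l) \<in> C" if l: "l < n" for l
        proof -
          have "row_card D k \<le> row_card C l" unfolding row_card_def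
            by (rule card_mono[OF finite_row[OF finC]])
              (use kn a(2) l subC in \<open>auto simp: D_def less_Suc_eq\<close>)
          then have "(row_card C l, col_card C i) \<notin> Z"
            using a(3) ci down_closedD[OF down] by fastforce
          then show ?thesis using box_closedD[OF C(1) a(1) l] by blast
        qed
        then show ?thesis using False by blast
      qed
    qed
  qed
  moreover have "A \<subseteq> D" using C(2) by (auto simp: D_def)
  ultimately have "D = Rect M (Suc n)" using sp by (auto simp: box_spans_def)
  then have "(i, k) \<in> C" if "i < M" "k < n" for i k
    using that by (auto simp: D_def set_eq_iff less_Suc_eq)
  then show "C = Rect M n" using subC by auto
qed (rule A)

lemma box_spans_drop_row:
  assumes down: "down_closed Z" and bnd: "\<And>r c. (r, c) \<in> Z \<Longrightarrow> c < n" and n: "0 < n"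
    and sp: "box_spans Z M (Suc n) A"
  shows "\<exists>B. box_spans Z M n B \<and> card B \<le> card A"
  using sp
proof (induction "row_card A n" arbitrary: A rule: less_induct)
  case less
  show ?case
  proof (cases "\<exists>i. (i, n) \<in> A")
    case True
    then obtain i where "(i, n) \<in> A" by blast
    then obtain A' where "box_spans Z M (Suc n) A'" "card A' \<le> card A" "row_card A' n < row_card A n"
      using last_row_shrink[OF down _ n less.prems] bnd by metis
    then show ?thesis using less.hyps[of A'] le_trans by blast
  next
    case False
    then have "A \<subseteq> Rect M n"
      using less.prems by (force simp: box_spans_def Rect_def less_Suc_eq)
    then show ?thesis using box_spans_drop_empty_row[OF down less.prems] by blast
  qed
qed

lemma box_spans_drop_rows:
  assumes down: "down_closed Z" and bnd: "\<And>r c. (r, c) \<in> Z \<Longrightarrow> c < b" and b: "0 < b"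
    and sp: "box_spans Z M (b + d) A"
  shows "\<exists>B. box_spans Z M b B \<and> card B \<le> card A"
  using sp
proof (induction d arbitrary: A)
  case (Suc d)
  have "\<exists>B. box_spans Z M (b + d) B \<and> card B \<le> card A"
    by (rule box_spans_drop_row[OF down]) (use bnd b Suc.prems in \<open>auto intro: trans_less_add1\<close>)
  then show ?case using Suc.IH le_trans by blast
qed auto

lemma row_card_converse [simp]: "row_card (A\<inverse>) k = col_card A k"
  by (simp add: row_card_def col_card_def)

lemma col_card_converse [simp]: "col_card (A\<inverse>) k = row_card A k"
  by (simp add: row_card_def col_card_def)

lemma box_closed_converse: "box_closed Z M N C \<Longrightarrow> box_closed (Z\<inverse>) N M (C\<inverse>)"
  by (auto simp: box_closed_def)

lemma box_spans_converse:
  assumes "box_spans Z M N A"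
  shows "box_spans (Z\<inverse>) N M (A\<inverse>)"
  unfolding box_spans_def
proof (intro conjI allI impI)
  show "A\<inverse> \<subseteq> Rect N M" using assms by (auto simp: box_spans_def)
  fix C assume C: "box_closed (Z\<inverse>) N M C" "A\<inverse> \<subseteq> C"
  then have "box_closed Z M N (C\<inverse>)" "A \<subseteq> C\<inverse>" using box_closed_converse[OF C(1)] by auto
  then have "C\<inverse> = Rect M N" using assms by (auto simp: box_spans_def)
  then have "C = (Rect M N)\<inverse>" by (metis converse_converse)
  then show "C = Rect N M" by auto
qed

text \<open>Surplus rows are removed first; surplus columns are the surplus rows of the transposed
  problem.\<close>

lemma box_spans_shrink:
  assumes down: "down_closed Z" and Z: "Z \<subseteq> Rect a b" and pos: "0 < a" "0 < b"
    and sp: "box_spans Z (a + c) (b + d) A"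
  shows "\<exists>B. box_spans Z a b B \<and> card B \<le> card A"
proof -
  obtain B where B: "box_spans Z (a + c) b B" "card B \<le> card A"
  proof -
    have "\<exists>B. box_spans Z (a + c) b B \<and> card B \<le> card A"
      by (rule box_spans_drop_rows[OF down _ pos(2) sp]) (use Z in auto)
    then show ?thesis using that by blast
  qed
  have "down_closed (Z\<inverse>)" using down by (auto simp: down_closed_def)
  then have "\<exists>B'. box_spans (Z\<inverse>) b a B' \<and> card B' \<le> card (B\<inverse>)"
    by (rule box_spans_drop_rows[OF _ _ pos(1) box_spans_converse[OF B(1)]]) (use Z in auto)
  then obtain B' where B': "box_spans (Z\<inverse>) b a B'" "card B' \<le> card (B\<inverse>)" by blast
  have "box_spans Z a b (B'\<inverse>)" using box_spans_converse[OF B'(1)] by simp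
  moreover have "card (B'\<inverse>) \<le> card A" using B'(2) B(2) by simp
  ultimately show ?thesis by blast
qed

section \<open>Passing between growth in the plane and growth in a box\<close>

lemma row_eq: "row (i, j) A = (if finite {i. (i, j) \<in> A} then enat (row_card A j) else \<infinity>)"
proof -
  have eq: "{y \<in> A. snd y = snd (i, j)} = (\<lambda>i. (i, j)) ` {i. (i, j) \<in> A}" by auto
  have inj: "inj_on (\<lambda>i. (i, j)) S" for S :: "nat set" by (auto simp: inj_on_def)
  show ?thesis unfolding row_def eq ecount_def row_card_def
    by (simp only: finite_image_iff[OF inj] card_image[OF inj])
qed

lemma col_eq: "col (i, j) A = (if finite {j. (i, j) \<in> A} then enat (col_card A i) else \<infinity>)"
proof -
  have eq: "{y \<in> A. fst y = fst (i, j)} = Pair i ` {j. (i, j) \<in> A}" by auto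
  have inj: "inj_on (Pair i) S" for S :: "nat set" by (auto simp: inj_on_def)
  show ?thesis unfolding col_def eq ecount_def col_card_def
    by (simp only: finite_image_iff[OF inj] card_image[OF inj])
qed

lemma in_Z_iff:
  "in_Z Z (row (i, j) A) (col (i, j) A) \<longleftrightarrow>
    finite {i. (i, j) \<in> A} \<and> finite {j. (i, j) \<in> A} \<and> (row_card A j, col_card A i) \<in> Z"
  by (auto simp: in_Z_def row_eq col_eq)

lemma mem_NG_iff:
  "(i, j) \<in> NG Z A \<longleftrightarrow> (i, j) \<in> A \<or>
    \<not> (finite {i. (i, j) \<in> A} \<and> finite {j. (i, j) \<in> A} \<and> (row_card A j, col_card A i) \<in> Z)"
  unfolding NG_def in_Z_iff[symmetric] by auto

text \<open>With enough initially empty lines in the box nothing is lost by restricting to it: all empty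
  columns behave alike, so a row that ever leaves the box already has \<open>a\<close> points inside.\<close>

lemma spans_imp_box_spans:
  assumes down: "down_closed Z" and Z: "Z \<subseteq> Rect a b"
    and A: "A \<subseteq> Rect m n" and sp: "spans Z A"
  shows "box_spans Z (a + m) (b + n) A"
  unfolding box_spans_def
proof (intro conjI allI impI)
  show "A \<subseteq> Rect (a + m) (b + n)" using A by (fastforce simp: Rect_def)
  fix C assume C: "box_closed Z (a + m) (b + n) C" "A \<subseteq> C"
  note finC = box_closed_finite[OF C(1)]
  define X where "X t = (NG Z ^^ t) A" for t
  have XS: "X (Suc t) = NG Z (X t)" for t by (simp add: X_def)
  have symc: "(i, j) \<in> X t \<longleftrightarrow> (m, j) \<in> X t" if "m \<le> i" for i j t
  proof (induction t arbitrary: j)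
    case 0 then show ?case using A that by (auto simp: X_def)
  next
    case (Suc t)
    then show ?case unfolding XS mem_NG_iff col_card_def by simp
  qed
  have symr: "(i, j) \<in> X t \<longleftrightarrow> (i, n) \<in> X t" if "n \<le> j" for i j t
  proof (induction t arbitrary: i)
    case 0 then show ?case using A that by (auto simp: X_def)
  next
    case (Suc t)
    then show ?case unfolding XS mem_NG_iff row_card_def by simp
  qed
  have XC: "X t \<inter> Rect (a + m) (b + n) \<subseteq> C" for t
  proof (induction t)
    case 0 then show ?case using C(2) by (auto simp: X_def)
  next
    case (Suc t)
    have "(i, j) \<in> C" if ij: "i < a + m" "j < b + n" and new: "(i, j) \<in> X (Suc t)" for i j
    proof (rule ccontr)
      assume notC: "(i, j) \<notin> C"
      then have inZ: "(row_card C j, col_card C i) \<in> Z" using box_closedD[OF C(1) ij] by blast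
      have "(m, j) \<notin> X t"
      proof
        assume "(m, j) \<in> X t"
        then have "(m + k, j) \<in> C" if "k < a" for k
          using symc[of "m + k" j t] Suc ij that by auto
        then have "(\<lambda>k. m + k) ` {..<a} \<subseteq> {i. (i, j) \<in> C}" by auto
        then have "card ((\<lambda>k. m + k) ` {..<a}) \<le> row_card C j"
          unfolding row_card_def by (rule card_mono[OF finite_row[OF finC]])
        then show False using inZ Z by (auto simp: card_image)
      qed
      then have "(i', j) \<notin> X t" if "m \<le> i'" for i' using symc that by blast
      then have "i' < m" if "(i', j) \<in> X t" for i' using that not_less by blast
      \<comment> \<open>Row \<open>j\<close> of \<open>X t\<close> stops before column
        \<open>m\<close>, hence lies in the box, where the induction hypothesis applies. The same is
        done below for column \<open>i\<close>.\<close>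
      then have subr: "{i. (i, j) \<in> X t} \<subseteq> {i. (i, j) \<in> C}"
        using Suc ij by (fastforce simp: Rect_def)
      have "(i, n) \<notin> X t"
      proof
        assume "(i, n) \<in> X t"
        then have "(i, n + k) \<in> C" if "k < b" for k
          using symr[of "n + k" i t] Suc ij that by auto
        then have "(\<lambda>k. n + k) ` {..<b} \<subseteq> {j. (i, j) \<in> C}" by auto
        then have "card ((\<lambda>k. n + k) ` {..<b}) \<le> col_card C i"
          unfolding col_card_def by (rule card_mono[OF finite_col[OF finC]])
        then show False using inZ Z by (auto simp: card_image)
      qed
      then have "(i, j') \<notin> X t" if "n \<le> j'" for j' using symr that by blast
      then have "j' < n" if "(i, j') \<in> X t" for j' using that not_less by blast
      then have subc: "{j. (i, j) \<in> X t} \<subseteq> {j. (i, j) \<in> C}"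
        using Suc ij by (fastforce simp: Rect_def)
      have "(row_card (X t) j, col_card (X t) i) \<in> Z"
        using down_closedD[OF down inZ] card_mono[OF finite_row[OF finC] subr]
          card_mono[OF finite_col[OF finC] subc] by (simp add: row_card_def col_card_def)
      moreover have "finite {i. (i, j) \<in> X t}" "finite {j. (i, j) \<in> X t}"
        using finite_subset[OF subr] finite_subset[OF subc] finite_row[OF finC] finite_col[OF finC] by auto
      ultimately have "(i, j) \<in> X t" using new by (simp add: XS mem_NG_iff)
      then show False using Suc ij notC by auto
    qed
    then show ?case by auto
  qed
  have "(\<Union>t. X t) = UNIV" using sp by (simp add: spans_def X_def)
  then have "Rect (a + m) (b + n) \<subseteq> C" using XC by blast
  then show "C = Rect (a + m) (b + n)" using box_closed_subset[OF C(1)] by auto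
qed

text \<open>Growth in the plane fills the box. Then each row meeting the box has \<open>a\<close>
  points and fills in one step, after which every column has \<open>b\<close> points and fills in
  the next.\<close>

lemma box_spans_imp_spans:
  assumes down: "down_closed Z" and Z: "Z \<subseteq> Rect a b" and sp: "box_spans Z a b B"
  shows "spans Z B"
proof -
  define X where "X t = (NG Z ^^ t) B" for t
  have XS: "X (Suc t) = NG Z (X t)" for t by (simp add: X_def)
  have mono: "X s \<subseteq> X t" if "s \<le> t" for s t
    unfolding X_def by (rule funpow_increasing[OF _ that]) (simp add: NG_def)
  \<comment> \<open>The trace of the final set on the box. Being finite, it is already present at
    some time \<open>T\<close>, so a point forced by \<open>C\<close> appears by time
    \<open>Suc T\<close>.\<close>
  define C where "C = (\<Union>t. X t) \<inter> Rect a b"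
  have "\<exists>T. C \<subseteq> X T"
    by (rule finite_subset_increasing) (use mono in \<open>auto simp: C_def\<close>)
  then obtain T where T: "C \<subseteq> X T" by blast
  have "box_closed Z a b C" unfolding box_closed_def
  proof (intro conjI allI impI)
    show "C \<subseteq> Rect a b" by (simp add: C_def)
    fix i j assume ij: "i < a" "j < b" "(row_card C j, col_card C i) \<notin> Z"
    show "(i, j) \<in> C"
    proof (rule ccontr)
      assume "(i, j) \<notin> C"
      then have "(i, j) \<notin> X (Suc T)" using ij by (auto simp: C_def)
      then have fin: "finite {i. (i, j) \<in> X T}" "finite {j. (i, j) \<in> X T}"
        and inZ: "(row_card (X T) j, col_card (X T) i) \<in> Z" by (auto simp: XS mem_NG_iff)
      have "row_card C j \<le> row_card (X T) j" "col_card C i \<le> col_card (X T) i"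
        unfolding row_card_def col_card_def using T by (auto intro!: card_mono fin)
      then show False using ij(3) inZ down_closedD[OF down] by blast
    qed
  qed
  moreover have "B \<subseteq> C" using sp mono[of 0] by (auto simp: C_def box_spans_def X_def)
  ultimately have "C = Rect a b" using sp by (auto simp: box_spans_def)
  then have R: "Rect a b \<subseteq> X T" using T by simp
  have rows: "(i, j) \<in> X (Suc T)" if "j < b" for i j
  proof (rule ccontr)
    assume "(i, j) \<notin> X (Suc T)"
    then have fin: "finite {i. (i, j) \<in> X T}" and "(row_card (X T) j, col_card (X T) i) \<in> Z"
      by (auto simp: XS mem_NG_iff)
    then have "row_card (X T) j < a" using Z by auto
    moreover have "card {..<a} \<le> row_card (X T) j"
      unfolding row_card_def by (rule card_mono[OF fin]) (use R that in auto)
    ultimately show False by simp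
  qed
  have "(i, j) \<in> X (Suc (Suc T))" for i j
  proof (rule ccontr)
    assume "(i, j) \<notin> X (Suc (Suc T))"
    then have fin: "finite {j. (i, j) \<in> X (Suc T)}"
      and "(row_card (X (Suc T)) j, col_card (X (Suc T)) i) \<in> Z"
      by (auto simp: XS[of "Suc T"] mem_NG_iff)
    then have "col_card (X (Suc T)) i < b" using Z by auto
    moreover have "card {..<b} \<le> col_card (X (Suc T)) i"
      unfolding col_card_def by (rule card_mono[OF fin]) (use rows in auto)
    ultimately show False by simp
  qed
  then have "X (Suc (Suc T)) = UNIV" by auto
  then show ?thesis unfolding spans_def X_def by blast
qed

theorem mainTheorem2:
  fixes Z :: "pt set" and a0 b0 :: nat
  assumes "zero_set Z" and "finite Z" and "0 < a0" and "0 < b0"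
    and "Z \<subseteq> Rect a0 b0"
  shows "gamma Z = (LEAST n. \<exists>A. A \<subseteq> Rect a0 b0 \<and> finite A \<and> spans Z A \<and> card A = n)"
proof -
  let ?P = "\<lambda>n. \<exists>A. finite A \<and> spans Z A \<and> card A = n"
  let ?Q = "\<lambda>n. \<exists>A. A \<subseteq> Rect a0 b0 \<and> finite A \<and> spans Z A \<and> card A = n"
  note down = zero_set_down_closed[OF assms(1)]
  have box: "\<exists>B. B \<subseteq> Rect a0 b0 \<and> finite B \<and> spans Z B \<and> card B \<le> card A"
    if A: "finite A" "spans Z A" for A
  proof -
    have "A \<subseteq> Rect (Suc (Max (fst ` A))) (Suc (Max (snd ` A)))"
      using A(1) by (auto simp: less_Suc_eq_le intro!: Max_ge) force+
    from spans_imp_box_spans[OF down assms(5) this A(2)]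
    obtain B where B: "box_spans Z a0 b0 B" "card B \<le> card A"
      using box_spans_shrink[OF down assms(5,3,4)] by blast
    then have "B \<subseteq> Rect a0 b0" by (simp add: box_spans_def)
    then show ?thesis
      using B box_spans_imp_spans[OF down assms(5) B(1)] finite_subset[OF _ finite_Rect] by blast
  qed
  \<comment> \<open>The full box witnesses that a finite spanning set exists, so the least
    cardinality is attained.\<close>
  have "box_spans Z a0 b0 (Rect a0 b0)" by (auto simp: box_spans_def box_closed_def)
  then have "spans Z (Rect a0 b0)" by (rule box_spans_imp_spans[OF down assms(5)])
  then have "?P (card (Rect a0 b0))" using finite_Rect by blast
  then have "?P (gamma Z)" unfolding gamma_def by (rule LeastI)
  then obtain A where A: "finite A" "spans Z A" "card A = gamma Z" by blast
  obtain B where B: "B \<subseteq> Rect a0 b0" "finite B" "spans Z B" "card B \<le> gamma Z"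
    using box[OF A(1,2)] A(3) by auto
  have min: "gamma Z \<le> n" if "?P n" for n unfolding gamma_def by (rule Least_le) (rule that)
  have "gamma Z \<le> card B" using B by (intro min) blast
  then have "card B = gamma Z" using B(4) by simp
  then have "?Q (gamma Z)" using B by auto
  then show ?thesis by (intro Least_equality[symmetric]) (use min in blast)+
qed

end
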